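(* Let $n\ge 3$ and $T_{3,n}=C_3\Box C_n$. Then $\chi(T_{3,n}^2)=6$ if $n$ is even; $\chi(T_{3,n}^2)=7$ if $n$ is odd and $n\ge 7$; $\chi(T_{3,5}^2)=8$; and $\chi(T_{3,3}^2)=9$.
   Context: $C_k$ denotes the cycle on $k$ vertices; $\Box$ is the Cartesian product of graphs. The square $G^2$ of a graph $G$ has vertex set $V(G)$, two distinct vertices being adjacent iff their distance in $G$ is at most 2. $\chi$ is the chromatic number. *)

theory Defs
  imports "Graph_Theory.Pair_Digraph" "Graph_Theory.Shortest_Path"
begin

text \<open>
  Finite simple graphs are the structures satisfying \<^locale>\<open>pair_graph\<close>: finite symmetric loop-free
  digraphs without parallel arcs, an undirected edge being a pair of opposite arcs.
\<close>

text \<open>The formula describes the cycle on \<open>k\<close> vertices only for \<open>k \<ge> 3\<close> (for \<open>k = 1\<close> it gives a loop).\<close>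

definition cycle_graph :: "nat \<Rightarrow> nat pair_pre_digraph" where
  "cycle_graph k =
     \<lparr> pverts = {..<k},
       parcs = {(i, j). i < k \<and> j < k \<and> (j = Suc i mod k \<or> i = Suc j mod k)} \<rparr>"

definition cartesian_product ::
  "'a pair_pre_digraph \<Rightarrow> 'b pair_pre_digraph \<Rightarrow> ('a \<times> 'b) pair_pre_digraph" (infixr "\<box>" 70) where
  "G \<box> H =
     \<lparr> pverts = pverts G \<times> pverts H,
       parcs = {((a, b), (c, d)).
                  (a = c \<and> a \<in> pverts G \<and> (b, d) \<in> parcs H) \<or>
                  (b = d \<and> b \<in> pverts H \<and> (a, c) \<in> parcs G)} \<rparr>"

text \<open>The distance is the shortest-path distance for unit arc weights; it is \<open>\<infinity>\<close> if there is no path.\<close>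

definition graph_dist :: "'a pair_pre_digraph \<Rightarrow> 'a \<Rightarrow> 'a \<Rightarrow> ereal" where
  "graph_dist G u v = wf_digraph.\<mu> (with_proj G) (\<lambda>_. 1) u v"

definition graph_square :: "'a pair_pre_digraph \<Rightarrow> 'a pair_pre_digraph" where
  "graph_square G =
     \<lparr> pverts = pverts G,
       parcs = {(u, v). u \<in> pverts G \<and> v \<in> pverts G \<and> u \<noteq> v \<and> graph_dist G u v \<le> 2} \<rparr>"

definition proper_colouring :: "'a pair_pre_digraph \<Rightarrow> nat \<Rightarrow> ('a \<Rightarrow> nat) \<Rightarrow> bool" where
  "proper_colouring G k c \<longleftrightarrow>
     (\<forall>v \<in> pverts G. c v < k) \<and> (\<forall>(u, v) \<in> parcs G. c u \<noteq> c v)"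

definition chromatic_number :: "'a pair_pre_digraph \<Rightarrow> nat" where
  "chromatic_number G = (LEAST k. \<exists>c. proper_colouring G k c)"

abbreviation T3 :: "nat \<Rightarrow> (nat \<times> nat) pair_pre_digraph" where
  "T3 n \<equiv> cycle_graph 3 \<box> cycle_graph n"

lemma pair_graph_iff:
  "pair_graph G \<longleftrightarrow>
     finite (pverts G) \<and> parcs G \<subseteq> pverts G \<times> pverts G \<and> sym (parcs G) \<and> irrefl (parcs G)"
    (is "?L \<longleftrightarrow> ?R")
proof
  assume ?L
  then interpret pair_graph G .
  show ?R
    using pair_finite_verts pair_sym_arcs in_arcsD1 in_arcsD2 pair_no_loops
    by (force simp: symmetric_def irrefl_def)
next
  assume R: ?R
  then have "finite (parcs G)"
    by (meson finite_SigmaI finite_subset)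
  with R show ?L
    by unfold_locales (auto simp: symmetric_def irrefl_def)
qed

lemma pair_graph_cycle_graph: "k \<ge> 3 \<Longrightarrow> pair_graph (cycle_graph k)"
  unfolding pair_graph_iff cycle_graph_def
  by (auto simp: sym_def irrefl_def mod_Suc)

lemma pair_graph_cartesian_product:
  "pair_graph G \<Longrightarrow> pair_graph H \<Longrightarrow> pair_graph (G \<box> H)"
  unfolding pair_graph_iff cartesian_product_def
  by (auto simp: sym_def irrefl_def)

lemma graph_dist_eq_INF:
  assumes "pair_graph G"
  shows "graph_dist G u v =
    (INF p \<in> {p. pre_digraph.awalk (with_proj G) u p v}. ereal (length p))"
proof -
  interpret pair_graph G by fact
  have "awalk_cost (\<lambda>_. 1) p = length p" for p :: "('a \<times> 'a) list"
    by (induction p) auto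
  then show ?thesis
    by (simp add: graph_dist_def \<mu>_def)
qed

lemma graph_dist_commute:
  assumes "pair_graph G"
  shows "graph_dist G u v = graph_dist G v u"
proof -
  interpret pair_graph G by fact
  have le: "graph_dist G x y \<le> graph_dist G y x" for x y
    unfolding graph_dist_eq_INF[OF assms]
  proof (rule INF_mono)
    fix p assume "p \<in> {p. pre_digraph.awalk (with_proj G) y p x}"
    then have "awalk x (rev_path p) y"
      by (simp add: awalk_rev_path)
    moreover have "length (rev_path p) = length p"
      by (induction p) auto
    ultimately show "\<exists>q \<in> {p. pre_digraph.awalk (with_proj G) x p y}. ereal (length q) \<le> ereal (length p)"
      by (intro bexI[of _ "rev_path p"]) auto
  qed
  show ?thesis
    by (intro antisym le)
qed

lemma pair_graph_graph_square:
  assumes "pair_graph G"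
  shows "pair_graph (graph_square G)"
  using assms graph_dist_commute[OF assms] unfolding pair_graph_iff graph_square_def
  by (auto simp: sym_def irrefl_def)

text \<open>A finite simple graph has a proper colouring, so the \<open>LEAST\<close> in the chromatic number is attained.\<close>

lemma ex_proper_colouring:
  assumes "pair_graph G"
  shows "\<exists>c. proper_colouring G (chromatic_number G) c"
proof -
  have fin: "finite (pverts G)" and sub: "parcs G \<subseteq> pverts G \<times> pverts G"
    and irr: "irrefl (parcs G)"
    using assms unfolding pair_graph_iff by auto
  obtain c where c: "bij_betw c (pverts G) {0..<card (pverts G)}"
    using fin ex_bij_betw_finite_nat by blast
  have "proper_colouring G (card (pverts G)) c"
    using c sub irr unfolding proper_colouring_def bij_betw_def inj_on_def irrefl_def
    by fastforce
  then show ?thesis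
    unfolding chromatic_number_def by (intro LeastI[of "\<lambda>k. \<exists>c. proper_colouring G k c"]) blast
qed

end

theory Submission
  imports Defs
begin

text \<open>
  In \<open>T3 n\<close> all vertices in the same column or in cyclically consecutive columns are at distance at
  most 2, while columns two apart only interact within a row. So a colour class of the square meets
  each column at most once and never two consecutive columns; it has at most \<open>n div 2\<close> elements, and
  counting the \<open>3 * n\<close> vertices gives \<open>3 * n \<le> k * (n div 2)\<close> for every proper \<open>k\<close>-colouring.
  This bound is attained for every \<open>n\<close>. For even \<open>n\<close>, even and odd columns get rotations of
  \<open>(0, 1, 2)\<close> and of \<open>(3, 4, 5)\<close>; for odd \<open>n \<ge> 7\<close>, five special columns using a seventh colour
  repair the parity.
\<close>

section \<open>The square of a graph\<close>

lemma graph_dist_le_2_iff: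
  assumes "pair_graph G" "u \<in> pverts G" "u \<noteq> v"
  shows "graph_dist G u v \<le> 2 \<longleftrightarrow>
    (u, v) \<in> parcs G \<or> (\<exists>w. (u, w) \<in> parcs G \<and> (w, v) \<in> parcs G)"
proof -
  interpret pair_graph G by fact
  have wfD: "x \<in> pverts G \<and> y \<in> pverts G" if "(x, y) \<in> parcs G" for x y
    using that in_arcsD1 in_arcsD2 by blast
  show ?thesis
  proof
    assume "graph_dist G u v \<le> 2"
    \<comment> \<open>An infimum at most 2 yields no walk by itself; being strictly below 3, it
      yields one of length below 3.\<close>
    then have "(INF p \<in> {p. awalk u p v}. ereal (length p)) < 3"
      unfolding graph_dist_eq_INF[OF assms(1)] by (rule order.strict_trans1) simp
    then obtain p where p: "awalk u p v" "length p < 3"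
      by (auto simp: INF_less_iff)
    from p(2) consider "p = []" | e where "p = [e]" | e f where "p = [e, f]"
      by (auto simp: less_Suc_eq numeral_eq_Suc length_Suc_conv)
    then show "(u, v) \<in> parcs G \<or> (\<exists>w. (u, w) \<in> parcs G \<and> (w, v) \<in> parcs G)"
      using p(1) assms(3) by cases (auto simp: awalk_simps)
  next
    assume "(u, v) \<in> parcs G \<or> (\<exists>w. (u, w) \<in> parcs G \<and> (w, v) \<in> parcs G)"
    then obtain p where p: "awalk u p v" "length p \<le> 2"
    proof (elim disjE exE conjE)
      assume "(u, v) \<in> parcs G"
      then show ?thesis
        using that[of "[(u, v)]"] wfD by (auto simp: awalk_simps)
    next
      fix w assume "(u, w) \<in> parcs G" "(w, v) \<in> parcs G"
      then show ?thesis
        using that[of "[(u, w), (w, v)]"] wfD by (auto simp: awalk_simps)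
    qed
    have "graph_dist G u v \<le> ereal (length p)"
      unfolding graph_dist_eq_INF[OF assms(1)] using p(1) by (intro INF_lower) simp
    also have "\<dots> \<le> 2"
      using p(2) by (simp add: numeral_eq_ereal)
    finally show "graph_dist G u v \<le> 2" .
  qed
qed

lemma parcs_graph_square:
  assumes "pair_graph G"
  shows "parcs (graph_square G) =
    {(u, v). u \<in> pverts G \<and> v \<in> pverts G \<and> u \<noteq> v \<and>
      ((u, v) \<in> parcs G \<or> (\<exists>w. (u, w) \<in> parcs G \<and> (w, v) \<in> parcs G))}"
  using graph_dist_le_2_iff[OF assms] unfolding graph_square_def by auto

lemma chromatic_number_eqI:
  assumes "proper_colouring G k c"
    and "\<And>k' c'. proper_colouring G k' c' \<Longrightarrow> k \<le> k'"
  shows "chromatic_number G = k"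
  unfolding chromatic_number_def using assms by (blast intro: Least_equality)

section \<open>Proper colourings of the square of \<open>T3 n\<close>\<close>

lemma pverts_square_T3: "pverts (graph_square (T3 n)) = {..<3} \<times> {..<n}"
  by (simp add: graph_square_def cartesian_product_def cycle_graph_def)

lemma Suc_mod_inj: "Suc i mod n = Suc j mod n \<Longrightarrow> i < n \<Longrightarrow> j < n \<Longrightarrow> i = j"
  by (auto simp: mod_Suc split: if_splits)

lemma parcs_cycle_graph_3: "(a, b) \<in> parcs (cycle_graph 3) \<longleftrightarrow> a < 3 \<and> b < 3 \<and> a \<noteq> b"
  by (auto simp: cycle_graph_def mod_Suc split: if_splits)

text \<open>\<open>x\<close>, \<open>y\<close>, \<open>z\<close> stand for consecutive columns.
  Conditions between \<open>y\<close> and \<open>z\<close> are left out, because each column in turn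
  takes the role of \<open>x\<close> and adjacency is symmetric.\<close>

definition columns_ok :: "nat \<Rightarrow> (nat \<Rightarrow> nat) \<Rightarrow> (nat \<Rightarrow> nat) \<Rightarrow> (nat \<Rightarrow> nat) \<Rightarrow> bool" where
  "columns_ok k x y z \<longleftrightarrow>
     (\<forall>a<3. x a < k \<and> (\<forall>b<3. (a \<noteq> b \<longrightarrow> x a \<noteq> x b) \<and> x a \<noteq> y b) \<and> x a \<noteq> z a)"

text \<open>Reduces colouring the square to windows of three cyclically consecutive columns; the
  lower bound and all the colourings work with this form.\<close>

lemma proper_colouring_square_T3_iff:
  assumes n: "n \<ge> 3"
  shows "proper_colouring (graph_square (T3 n)) k c \<longleftrightarrow>
    (\<forall>i<n. columns_ok k (\<lambda>a. c (a, i)) (\<lambda>a. c (a, Suc i mod n))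
      (\<lambda>a. c (a, Suc (Suc i) mod n)))"
    (is "?L \<longleftrightarrow> ?R")
proof -
  have pg: "pair_graph (T3 n)"
    using n by (intro pair_graph_cartesian_product pair_graph_cycle_graph) auto
  have arc: "((a, i), (b, j)) \<in> parcs (T3 n) \<longleftrightarrow> a < 3 \<and> b < 3 \<and> i < n \<and> j < n \<and>
      (a = b \<and> (j = Suc i mod n \<or> i = Suc j mod n) \<or> i = j \<and> a \<noteq> b)" for a b i j
    using parcs_cycle_graph_3[of a b]
    by (auto simp: cartesian_product_def cycle_graph_def)
  have vert: "(a, i) \<in> pverts (T3 n) \<longleftrightarrow> a < 3 \<and> i < n" for a i
    by (simp add: cartesian_product_def cycle_graph_def)
  note sq = parcs_graph_square[OF pg]
  have lt: "Suc i mod n < n" for i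
    using n by simp
  \<comment> \<open>With at least three columns, neither one nor two forward steps return to the
    start, so the vertices compared below are distinct.\<close>
  have ne: "Suc i mod n \<noteq> i" "Suc (Suc i) mod n \<noteq> i" if "i < n" for i
    using n that by (auto simp: mod_Suc)
  show ?thesis
  proof
    assume L: ?L
    then have dist: "c x \<noteq> c y" if "(x, y) \<in> parcs (graph_square (T3 n))" for x y
      using that by (auto simp: proper_colouring_def)
    show ?R
      unfolding columns_ok_def
    proof (intro allI impI conjI)
      fix a i :: nat assume ai: "a < 3" "i < n"
      show "c (a, i) < k"
        using L ai by (auto simp: proper_colouring_def pverts_square_T3)
      show "c (a, i) \<noteq> c (a, Suc (Suc i) mod n)"
      proof (rule dist)
        have "((a, i), (a, Suc i mod n)) \<in> parcs (T3 n)"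
          "((a, Suc i mod n), (a, Suc (Suc i) mod n)) \<in> parcs (T3 n)"
          using ai lt by (auto simp: arc mod_Suc_eq)
        then show "((a, i), (a, Suc (Suc i) mod n)) \<in> parcs (graph_square (T3 n))"
          using ai lt ne[OF ai(2)] unfolding sq by (auto simp: vert)
      qed
      fix b :: nat assume b: "b < 3"
      show "c (a, i) \<noteq> c (b, i)" if "a \<noteq> b"
        using that ai b by (intro dist) (auto simp: sq vert arc)
      show "c (a, i) \<noteq> c (b, Suc i mod n)"
      proof (rule dist)
        \<comment> \<open>If the rows differ, the walk changes row first and passes through
          \<open>(b, i)\<close>.\<close>
        have "((a, i), (b, Suc i mod n)) \<in> parcs (T3 n) \<or>
          ((a, i), (b, i)) \<in> parcs (T3 n) \<and> ((b, i), (b, Suc i mod n)) \<in> parcs (T3 n)"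
          using ai b lt by (auto simp: arc)
        then show "((a, i), (b, Suc i mod n)) \<in> parcs (graph_square (T3 n))"
          using ai b lt ne[OF ai(2)] unfolding sq by (auto simp: vert)
      qed
    qed
  next
    assume R: ?R
    show ?L
      unfolding proper_colouring_def
    proof (intro conjI ballI)
      fix v assume "v \<in> pverts (graph_square (T3 n))"
      then show "c v < k"
        using R by (auto simp: columns_ok_def pverts_square_T3)
    next
      fix e assume e_arc: "e \<in> parcs (graph_square (T3 n))"
      obtain a i b j where e: "e = ((a, i), (b, j))"
        by (metis prod.exhaust)
      have ab: "a < 3" "b < 3" "i < n" "j < n" and
        adj: "((a, i), (b, j)) \<in> parcs (T3 n) \<or>
          (\<exists>d l. ((a, i), (d, l)) \<in> parcs (T3 n) \<and> ((d, l), (b, j)) \<in> parcs (T3 n))" and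
        distinct: "(a, i) \<noteq> (b, j)"
        using e_arc unfolding sq e by (auto simp: vert)
      \<comment> \<open>Moving two columns uses up both arcs, so the row is kept. A forward step
        followed by a backward one ends in the same column by \<open>Suc_mod_inj\<close>.\<close>
      have "i = j \<or> j = Suc i mod n \<or> i = Suc j mod n \<or>
        a = b \<and> (j = Suc (Suc i) mod n \<or> i = Suc (Suc j) mod n)"
        using adj
      proof (elim disjE exE conjE)
        fix d l assume "((a, i), (d, l)) \<in> parcs (T3 n)" "((d, l), (b, j)) \<in> parcs (T3 n)"
        then show ?thesis
          unfolding arc using Suc_mod_inj[of i n j] by (elim conjE disjE) (simp_all add: mod_Suc_eq)
      qed (auto simp: arc)
      then have "c (a, i) \<noteq> c (b, j)"
        using R ab distinct unfolding columns_ok_def by (metis prod.inject)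
      then show "case e of (u, v) \<Rightarrow> c u \<noteq> c v"
        by (simp add: e)
    qed
  qed
qed

section \<open>Lower bound\<close>

text \<open>The cyclic shift of \<open>S\<close> by one is disjoint from \<open>S\<close> and
  equally large, and both fit into \<open>n\<close> positions.\<close>

lemma cycle_independent_card:
  assumes "S \<subseteq> {..<n}" and "\<And>i. i \<in> S \<Longrightarrow> Suc i mod n \<notin> S"
  shows "card S \<le> n div 2"
proof -
  let ?f = "\<lambda>i. Suc i mod n"
  have "inj_on ?f S"
    using assms(1) by (intro inj_onI) (blast intro: Suc_mod_inj)
  then have "card S + card S = card (S \<union> ?f ` S)"
    using assms finite_subset[OF assms(1)]
    by (subst card_Un_disjoint) (auto simp: card_image)
  also have "\<dots> \<le> card {..<n}"
    using assms(1) by (intro card_mono) (auto intro!: mod_less_divisor)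
  finally show ?thesis
    by simp
qed

lemma proper_colouring_square_T3_lower_bound:
  assumes n: "n \<ge> 3" and "proper_colouring (graph_square (T3 n)) k c"
  shows "3 * n \<le> k * (n div 2)"
proof -
  let ?V = "{..<3::nat} \<times> {..<n}"
  note col = assms(2)[unfolded proper_colouring_square_T3_iff[OF n] columns_ok_def, rule_format]
  have "card {v \<in> ?V. c v = q} \<le> n div 2" for q
  proof -
    let ?C = "{v \<in> ?V. c v = q}"
    \<comment> \<open>The entries of a column are pairwise distinct, so a colour class is as large
      as the set of columns it meets.\<close>
    have "inj_on snd ?C"
      using col by (intro inj_onI) force
    then have "card ?C = card (snd ` ?C)"
      by (simp add: card_image)
    also have "\<dots> \<le> n div 2"
    proof (rule cycle_independent_card)
      fix i assume "i \<in> snd ` ?C"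
      then show "Suc i mod n \<notin> snd ` ?C"
        using col by force
    qed auto
    finally show ?thesis .
  qed
  then have "(\<Sum>q<k. card {v \<in> ?V. c v = q}) \<le> (\<Sum>q<k. n div 2)"
    by (rule sum_mono)
  moreover have "card (\<Union>q<k. {v \<in> ?V. c v = q}) = (\<Sum>q<k. card {v \<in> ?V. c v = q})"
    by (rule card_UN_disjoint) auto
  moreover have "(\<Union>q<k. {v \<in> ?V. c v = q}) = ?V"
    using col by auto
  ultimately show ?thesis
    by simp
qed

section \<open>Colourings\<close>

lemma all_less_3: "(\<forall>a<3. P a) \<longleftrightarrow> P 0 \<and> P 1 \<and> P (2::nat)"
  by (auto simp: numeral_eq_Suc less_Suc_eq)

definition rotation :: "nat \<Rightarrow> nat \<Rightarrow> nat \<Rightarrow> nat" where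
  "rotation s r a = (a + s) mod 3 + 3 * r"

text \<open>Different second arguments give disjoint colour blocks, so neighbouring columns never
  clash; two columns apart, different shifts disagree in every row.\<close>

lemma columns_ok_rotation:
  assumes "s < 3" "t < 3" "s \<noteq> t" "k \<ge> 6"
  shows "columns_ok k (rotation s 0) (rotation s 1) (rotation t 0)"
    and "columns_ok k (rotation s 1) (rotation t 0) (rotation t 1)"
proof -
  have "s \<in> {0, 1, 2}" "t \<in> {0, 1, 2}"
    using assms by auto
  then show "columns_ok k (rotation s 0) (rotation s 1) (rotation t 0)"
    and "columns_ok k (rotation s 1) (rotation t 0) (rotation t 1)"
    using assms unfolding columns_ok_def all_less_3
    by (auto simp: rotation_def)
qed

text \<open>
  Consecutive pairs of columns are rotated differently, and only the first pair is unrotated, so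
  the pattern closes up cyclically.
\<close>

definition even_colouring :: "nat \<times> nat \<Rightarrow> nat" where
  "even_colouring =
     (\<lambda>(a, i). rotation (if i < 2 then 0 else Suc (i div 2 mod 2)) (i mod 2) a)"

lemma proper_even_colouring:
  assumes "n \<ge> 3" "even n"
  shows "proper_colouring (graph_square (T3 n)) 6 even_colouring"
  unfolding proper_colouring_square_T3_iff[OF assms(1)]
proof (intro allI impI)
  fix i assume i: "i < n"
  define m where "m = n div 2"
  define j where "j = i div 2"
  define s :: "nat \<Rightarrow> nat" where "s j = (if j = 0 then 0 else Suc (j mod 2))" for j
  have m: "n = 2 * m" "m \<ge> 2"
    using assms by (auto simp: m_def)
  have j: "j < m"
    using i m(1) by (simp add: j_def)
  have col: "(\<lambda>a. even_colouring (a, 2 * l)) = rotation (s l) 0"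
    "(\<lambda>a. even_colouring (a, Suc (2 * l))) = rotation (s l) 1" for l
    by (auto simp: even_colouring_def s_def)
  \<comment> \<open>At the wrap-around the last index is positive because \<open>m \<ge> 2\<close>,
    so its shift is 1 or 2, while \<open>s 0\<close> is 0.\<close>
  have "s j \<noteq> s (Suc j mod m)"
    using j m(2) by (auto simp: s_def mod_Suc)
  moreover have "s l < 3" for l
    by (auto simp: s_def)
  ultimately have ok:
    "columns_ok 6 (rotation (s j) 0) (rotation (s j) 1) (rotation (s (Suc j mod m)) 0)"
    "columns_ok 6 (rotation (s j) 1) (rotation (s (Suc j mod m)) 0) (rotation (s (Suc j mod m)) 1)"
    by (simp_all add: columns_ok_rotation del: One_nat_def)
  have next_even: "Suc (Suc (2 * j)) mod n = 2 * (Suc j mod m)"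
    using j m by (auto simp: mod_Suc)
  have "Suc j < m \<or> Suc j = m"
    using j by linarith
  then have next_odd: "Suc (Suc (Suc (2 * j))) mod n = Suc (2 * (Suc j mod m))"
    using m by (auto simp: le_mod_geq)
  have here: "Suc (2 * j) mod n = Suc (2 * j)"
    using j m by simp
  have "i = 2 * j \<or> i = Suc (2 * j)"
    unfolding j_def by linarith
  then show "columns_ok 6 (\<lambda>a. even_colouring (a, i)) (\<lambda>a. even_colouring (a, Suc i mod n))
      (\<lambda>a. even_colouring (a, Suc (Suc i) mod n))"
  proof
    assume "i = 2 * j"
    then show ?thesis
      by (simp only: here next_even col ok)
  next
    assume "i = Suc (2 * j)"
    then show ?thesis
      by (simp only: next_even next_odd col ok)
  qed
qed

text \<open>
  The five leading columns, found by computer search, are compatible with both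
  possible rotations of the last pair of columns.
\<close>

definition leading_columns :: "nat list list" where
  "leading_columns = [[2, 0, 6], [1, 3, 4], [0, 6, 5], [2, 4, 1], [5, 3, 6]]"

definition odd_colouring :: "nat \<times> nat \<Rightarrow> nat" where
  "odd_colouring = (\<lambda>(a, i).
     if i < 5 then leading_columns ! i ! a
     else rotation ((i - 5) div 2 mod 2) ((i - 5) mod 2) a)"

text \<open>These are the windows meeting the leading columns. The rotated part starts with shift 0,
  but the shift of its last pair depends on \<open>n\<close>, hence the parameter
  \<open>s\<close>.\<close>

lemma columns_ok_leading:
  fixes L :: "nat \<Rightarrow> nat \<Rightarrow> nat"
  defines "L \<equiv> \<lambda>i a. leading_columns ! i ! a"
  shows "columns_ok 7 (L 0) (L 1) (L 2)" "columns_ok 7 (L 1) (L 2) (L 3)"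
    "columns_ok 7 (L 2) (L 3) (L 4)" "columns_ok 7 (L 3) (L 4) (rotation 0 0)"
    "columns_ok 7 (L 4) (rotation 0 0) (rotation 0 1)"
    "s < 2 \<Longrightarrow> columns_ok 7 (rotation s 0) (rotation s 1) (L 0)"
    "s < 2 \<Longrightarrow> columns_ok 7 (rotation s 1) (L 0) (L 1)"
  unfolding columns_ok_def all_less_3 L_def leading_columns_def rotation_def
  by (auto simp: less_2_cases_iff)

lemma proper_odd_colouring:
  assumes "odd n" "n \<ge> 7"
  shows "proper_colouring (graph_square (T3 n)) 7 odd_colouring"
proof -
  define m where "m = (n - 5) div 2"
  have m: "n = 5 + 2 * m" "m \<ge> 1"
    using assms by (auto simp: m_def elim!: oddE)
  have lead: "(\<lambda>a. odd_colouring (a, i)) = (\<lambda>a. leading_columns ! i ! a)" if "i < 5" for i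
    using that by (simp add: odd_colouring_def)
  have col: "(\<lambda>a. odd_colouring (a, 5 + 2 * l)) = rotation (l mod 2) 0"
    "(\<lambda>a. odd_colouring (a, 6 + 2 * l)) = rotation (l mod 2) 1" for l
    by (auto simp: odd_colouring_def)
  have col0: "(\<lambda>a. odd_colouring (a, 5)) = rotation 0 0"
    "(\<lambda>a. odd_colouring (a, 6)) = rotation 0 1"
    using col[of 0] by simp_all
  have "columns_ok 7 (\<lambda>a. odd_colouring (a, i)) (\<lambda>a. odd_colouring (a, Suc i mod n))
      (\<lambda>a. odd_colouring (a, Suc (Suc i) mod n))" if i: "i < n" for i
  proof (cases "i < 5")
    case True
    then have "Suc i mod n = Suc i" "Suc (Suc i) mod n = Suc (Suc i)"
      using m by auto
    moreover from True have "i \<in> {0, 1, 2, 3, 4}"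
      by auto
    ultimately show ?thesis
      by (auto simp: lead col0 columns_ok_leading numeral_2_eq_2[symmetric]
            columns_ok_leading[unfolded One_nat_def])
  next
    case False
    define j where "j = (i - 5) div 2"
    have j: "j < m"
      using False i m(1) by (simp add: j_def)
    \<comment> \<open>Plain alternation suffices here: the leading columns separate the last rotated
      pair from the first.\<close>
    have "j mod 2 \<noteq> Suc j mod 2"
      by (simp add: mod_Suc)
    then have ok: "columns_ok 7 (rotation (j mod 2) 0) (rotation (j mod 2) 1) (rotation (Suc j mod 2) 0)"
      "columns_ok 7 (rotation (j mod 2) 1) (rotation (Suc j mod 2) 0) (rotation (Suc j mod 2) 1)"
      by (simp_all add: columns_ok_rotation less_trans[OF mod_less_divisor] del: One_nat_def)
    have "i = 5 + 2 * j \<or> i = 6 + 2 * j"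
      using False unfolding j_def by linarith
    moreover have "Suc j < m \<or> Suc j = m"
      using j by linarith
    ultimately consider
        "i = 5 + 2 * j" "Suc i mod n = 6 + 2 * j" "Suc (Suc i) mod n = 5 + 2 * Suc j"
      | "i = 6 + 2 * j" "Suc i mod n = 5 + 2 * Suc j" "Suc (Suc i) mod n = 6 + 2 * Suc j"
      | "i = 5 + 2 * j" "Suc i mod n = 6 + 2 * j" "Suc (Suc i) mod n = 0"
      | "i = 6 + 2 * j" "Suc i mod n = 0" "Suc (Suc i) mod n = 1"
      using m by (auto simp: le_mod_geq)
    then show ?thesis
    proof cases
      case 1
      then show ?thesis
        by (simp only: col ok)
    next
      case 2
      then show ?thesis
        by (simp only: col ok)
    next
      case 3
      then show ?thesis
        by (simp add: col lead columns_ok_leading del: One_nat_def)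
    next
      case 4
      then show ?thesis
        by (simp add: col lead columns_ok_leading del: One_nat_def)
    qed
  qed
  then show ?thesis
    using assms by (subst proper_colouring_square_T3_iff) auto
qed

text \<open>Classes have at most two of the 15 vertices; here seven colours occur twice and one
  occurs once.\<close>

lemma proper_colouring_T3_5:
  "proper_colouring (graph_square (T3 5)) 8
     (\<lambda>(a, i). [[0, 1, 2], [3, 4, 5], [1, 0, 6], [2, 3, 4], [5, 6, 7]] ! i ! a)"
proof -
  have "(\<forall>i<5. P i) \<longleftrightarrow> P 0 \<and> P 1 \<and> P 2 \<and> P 3 \<and> P (4::nat)" for P
    by (auto simp: numeral_eq_Suc less_Suc_eq)
  then show ?thesis
    by (subst proper_colouring_square_T3_iff) (simp_all add: columns_ok_def all_less_3)
qed

text \<open>With three columns any two vertices are adjacent in the square, so all nine get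
  different colours.\<close>

lemma proper_colouring_T3_3:
  "proper_colouring (graph_square (T3 3)) 9 (\<lambda>(a, i). a + 3 * i)"
  by (subst proper_colouring_square_T3_iff) (simp_all add: columns_ok_def all_less_3)

theorem theorem5:
  fixes n :: nat
  assumes "n \<ge> 3"
  shows "(even n \<longrightarrow> chromatic_number (graph_square (T3 n)) = 6) \<and>
         (odd n \<and> n \<ge> 7 \<longrightarrow> chromatic_number (graph_square (T3 n)) = 7) \<and>
         chromatic_number (graph_square (T3 5)) = 8 \<and>
         chromatic_number (graph_square (T3 3)) = 9"
proof (intro conjI impI)
  assume "even n"
  then obtain m where m: "n = 2 * m" "m > 0"
    using assms by (auto elim!: evenE)
  show "chromatic_number (graph_square (T3 n)) = 6"
  proof (rule chromatic_number_eqI[OF proper_even_colouring[OF assms \<open>even n\<close>]])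
    fix k c assume "proper_colouring (graph_square (T3 n)) k c"
    from proper_colouring_square_T3_lower_bound[OF assms this] show "6 \<le> k"
      using m by simp
  qed
next
  assume n: "odd n \<and> 7 \<le> n"
  then obtain m where m: "n = Suc (2 * m)"
    by (auto elim!: oddE)
  show "chromatic_number (graph_square (T3 n)) = 7"
  proof (rule chromatic_number_eqI)
    show "proper_colouring (graph_square (T3 n)) 7 odd_colouring"
      using n by (intro proper_odd_colouring) auto
    fix k c assume "proper_colouring (graph_square (T3 n)) k c"
    \<comment> \<open>Rounding \<open>n div 2\<close> down to \<open>m\<close> leaves a surplus of
      3, which rules out six colours.\<close>
    from proper_colouring_square_T3_lower_bound[OF assms this] have "3 + 6 * m \<le> k * m"
      using m by simp
    then have "6 * m < k * m"
      by linarith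
    then show "7 \<le> k"
      by simp
  qed
next
  show "chromatic_number (graph_square (T3 5)) = 8"
  proof (rule chromatic_number_eqI[OF proper_colouring_T3_5])
    fix k c assume "proper_colouring (graph_square (T3 5)) k c"
    from proper_colouring_square_T3_lower_bound[OF _ this] show "8 \<le> k"
      by simp
  qed
next
  show "chromatic_number (graph_square (T3 3)) = 9"
  proof (rule chromatic_number_eqI[OF proper_colouring_T3_3])
    fix k c assume "proper_colouring (graph_square (T3 3)) k c"
    from proper_colouring_square_T3_lower_bound[OF _ this] show "9 \<le> k"
      by simp
  qed
qed

end
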